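(* Let $p\equiv 1\pmod 4$ be a prime and fix any primitive root $g$ of $p$. Let $X=\{(a,b)\in V\times V : a<b<\overline{a}<\overline{b}\}$ and $L_p=(p-1)(p-5)/96$. Then $$\prod_{\substack{1\le i<j\le (p-1)/2\\ i^2+j^2\not\equiv 0 \pmod p}} (j^2-i^2)\equiv (-1)^{|X|+L_p}\prod_{\substack{r,s=1\\ r\ne s}}^{(p-1)/4}(g^{4r}-g^{4s}) \pmod p.$$
   Context: For an integer $x$, $\{x\}_p$ denotes the least nonnegative residue of $x$ modulo $p$, and $\widetilde{x}=p-\{x\}_p$ if $\{x\}_p>p/2$, while $\widetilde{x}=\{x\}_p$ if $\{x\}_p<p/2$. Let $t=\prod_{x=1}^{(p-1)/2}x$. Let $V=\{x : 1\le x\le (p-1)/2,\ x<\widetilde{tx}\}$, and for $a\in V$ put $\overline{a}=\widetilde{ta}$. *)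

theory Defs
  imports "HOL-Number_Theory.Number_Theory"
begin

definition least_res :: "nat \<Rightarrow> int \<Rightarrow> int" where
  "least_res p x = x mod int p"

text \<open>The tie \<^term>\<open>2 * least_res p x = int p\<close> cannot occur for odd \<^term>\<open>p\<close>.\<close>

definition abs_res :: "nat \<Rightarrow> int \<Rightarrow> int" where
  "abs_res p x = (if 2 * least_res p x > int p then int p - least_res p x else least_res p x)"

definition half_fact :: "nat \<Rightarrow> int" where
  "half_fact p = (\<Prod>x = 1..(int p - 1) div 2. x)"

definition bar :: "nat \<Rightarrow> int \<Rightarrow> int" where
  "bar p a = abs_res p (half_fact p * a)"

definition V_set :: "nat \<Rightarrow> int set" where
  "V_set p = {x. 1 \<le> x \<and> x \<le> (int p - 1) div 2 \<and> x < abs_res p (half_fact p * x)}"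

definition X_set :: "nat \<Rightarrow> (int \<times> int) set" where
  "X_set p = {(a, b) \<in> V_set p \<times> V_set p. a < b \<and> b < bar p a \<and> bar p a < bar p b}"

definition L_num :: "nat \<Rightarrow> nat" where
  "L_num p = (p - 1) * (p - 5) div 96"

text \<open>For primes \<^term>\<open>p\<close> congruent to 1 modulo 4 neither the truncated subtractions nor the integer
  division in \<^const>\<open>L_num\<close> lose anything.\<close>

lemma L_num_exact:
  assumes "prime p" and "[p = 1] (mod 4)"
  shows "96 * int (L_num p) = (int p - 1) * (int p - 5)"
proof -
  have mod4: "p mod 4 = 1" using assms(2) by (simp add: cong_def)
  then obtain k where k: "p = 4 * k + 1" by (metis mult_div_mod_eq)
  have "p \<noteq> 1" using assms(1) by auto
  then obtain m where m: "k = Suc m" using k by (cases k) auto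
  have p: "p = 4 * m + 5" using k m by simp
  have "\<not> 3 dvd p"
  proof
    assume "3 dvd p"
    then have "3 = p" using assms(1) primes_dvd_imp_eq[of 3 p] by simp
    then show False using p by simp
  qed
  then have "3 dvd m \<or> 3 dvd (m + 1)"
    unfolding p by presburger
  then have "3 dvd (m + 1) * m"
    by (meson dvd_mult dvd_mult2)
  moreover have "2 dvd (m + 1) * m" by simp
  moreover have "coprime 2 (3 :: nat)" by simp
  ultimately have "2 * 3 dvd (m + 1) * m"
    using divides_mult by blast
  then obtain c where "(m + 1) * m = 2 * 3 * c" by (elim dvdE)
  then have c: "(m + 1) * m = 6 * c" by simp
  have eq: "(p - 1) * (p - 5) = 96 * c"
  proof -
    have "(p - 1) * (p - 5) = 16 * ((m + 1) * m)" unfolding p by (simp add: algebra_simps)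
    then show ?thesis unfolding c by simp
  qed
  then have "96 * L_num p = (p - 1) * (p - 5)" by (simp add: L_num_def)
  then have "96 * int (L_num p) = int ((p - 1) * (p - 5))" by presburger
  also have "\<dots> = (int p - 1) * (int p - 5)" using p by (simp add: of_nat_diff)
  finally show ?thesis .
qed

text \<open>\<^const>\<open>residue_primroot\<close> only takes natural numbers; an integer is a primitive root iff its least
  nonnegative residue is.\<close>

definition int_primroot :: "nat \<Rightarrow> int \<Rightarrow> bool" where
  "int_primroot p g \<longleftrightarrow> residue_primroot p (nat (least_res p g))"

end

theory Submission
  imports Defs
begin

text \<open>
  Write \<open>p = 4 * n + 1\<close>. By Wilson's theorem \<open>t\<^sup>2 = -1\<close> modulo \<open>p\<close>, so \<open>bar\<close> is a fixed-point free
  involution of \<open>{1..2 * n}\<close> with \<open>(bar a)\<^sup>2 = - a\<^sup>2\<close>, and the excluded pairs are exactly the chords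
  \<open>{a, bar a}\<close>. Two distinct chords with left ends \<open>a < b\<close> contribute four factors to the product,
  whose product is \<open>(b\<^sup>4 - a\<^sup>4)\<^sup>2\<close> up to a sign that is negative iff the chords cross, i.e. iff
  \<open>(a, b) \<in> X\<close>. As \<open>a\<close> runs through \<open>V\<close>, \<open>a\<^sup>4\<close> runs through all \<open>n\<close> fourth powers, so the right-hand
  product is the same product of squares times \<open>(-1)\<close> to the power \<open>n choose 2\<close>, which is \<open>3 * L_num p\<close>.
\<close>

section \<open>Products over pairs, involutions and counting\<close>

text \<open>The condition \<open>j \<noteq> \<beta> i\<close> says that \<open>i\<close> and
  \<open>j\<close> lie in different orbits, so pairs can be grouped by the left ends
  \<open>a < b\<close> of their two orbits. Each group consists of the four choices of one element
  per orbit. Since \<open>a < b < \<beta> b\<close>, only the order of \<open>b\<close> and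
  \<open>\<beta> a\<close> and that of \<open>\<beta> a\<close> and \<open>\<beta> b\<close> stay
  open; hence \<open>min\<close> and \<open>max\<close> in the last two factors.\<close>

lemma prod_pairs_involution:
  fixes A :: "'a::linorder set" and f :: "'a \<Rightarrow> 'a \<Rightarrow> 'b::comm_monoid_mult"
  assumes fin: "finite A" and closed: "\<And>x. x \<in> A \<Longrightarrow> \<beta> x \<in> A"
    and invol: "\<And>x. x \<in> A \<Longrightarrow> \<beta> (\<beta> x) = x" and no_fix: "\<And>x. x \<in> A \<Longrightarrow> \<beta> x \<noteq> x"
  defines "V \<equiv> {x \<in> A. x < \<beta> x}"
  shows "(\<Prod>(i, j) \<in> {(i, j). i \<in> A \<and> j \<in> A \<and> i < j \<and> j \<noteq> \<beta> i}. f i j) =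
    (\<Prod>(a, b) \<in> {(a, b). a \<in> V \<and> b \<in> V \<and> a < b}.
       f a b * f a (\<beta> b) * f (min b (\<beta> a)) (max b (\<beta> a)) * f (min (\<beta> a) (\<beta> b)) (max (\<beta> a) (\<beta> b)))"
    (is "prod ?f ?S = prod ?g ?T")
proof -
  \<comment> \<open>\<open>v\<close> sends an element to the left end of its orbit, and
    \<open>\<psi>\<close> sends a pair to the ordered pair of left ends; the product is split along
    the fibres of \<open>\<psi>\<close>.\<close>
  define v where "v x = min x (\<beta> x)" for x
  define \<psi> where "\<psi> = (\<lambda>(i, j). (min (v i) (v j), max (v i) (v j)))"
  have finS: "finite ?S"
    by (rule finite_subset[of _ "A \<times> A"]) (use fin in auto)
  have finT: "finite ?T"
    by (rule finite_subset[of _ "A \<times> A"]) (use fin in \<open>auto simp: V_def\<close>)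
  have vV: "v x \<in> V" if "x \<in> A" for x
    using that closed[OF that] invol[OF that] no_fix[OF that] by (auto simp: V_def v_def min_def)
  have v_eq: "v x = a \<longleftrightarrow> x = a \<or> x = \<beta> a" if "x \<in> A" "a \<in> V" for x a
    using that invol[of x] invol[of a] no_fix[of x] by (auto simp: V_def v_def min_def)
  have v_neq: "v i \<noteq> v j" if "(i, j) \<in> ?S" for i j
  proof
    assume "v i = v j"
    then have "i = v j \<or> i = \<beta> (v j)" using v_eq[of i "v j"] vV[of j] that by auto
    then show False using that invol[of j] by (auto simp: v_def min_def split: if_splits)
  qed
  have "\<psi> ` ?S \<subseteq> ?T"
  proof
    fix y assume "y \<in> \<psi> ` ?S"
    then obtain i j where ij: "(i, j) \<in> ?S" and y: "y = \<psi> (i, j)" by auto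
    show "y \<in> ?T" using v_neq[OF ij] ij vV[of i] vV[of j]
      by (auto simp: y \<psi>_def min_def max_def)
  qed
  then have "prod ?f ?S = (\<Prod>y \<in> ?T. prod ?f {x \<in> ?S. \<psi> x = y})"
    using prod.group[OF finS finT, of \<psi> ?f] by simp
  also have "\<dots> = prod ?g ?T"
  proof (rule prod.cong[OF refl])
    fix y assume "y \<in> ?T"
    then obtain a b where y: "y = (a, b)" and a: "a \<in> V" and b: "b \<in> V" and ab: "a < b" by auto
    have A: "a \<in> A" "b \<in> A" "a < \<beta> a" "b < \<beta> b" "\<beta> a \<in> A" "\<beta> b \<in> A"
      using a b closed unfolding V_def by blast+
    have ne: "\<beta> a \<noteq> \<beta> b" "\<beta> a \<noteq> b" "\<beta> b \<noteq> a"
      using invol A ab by (metis order_less_asym)+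
    have psi: "\<psi> (i, j) = (a, b) \<longleftrightarrow> v i = a \<and> v j = b \<or> v i = b \<and> v j = a" for i j
      using ab by (auto simp: \<psi>_def min_def max_def)
    have "{x \<in> ?S. \<psi> x = y} = {(a, b), (a, \<beta> b), (min b (\<beta> a), max b (\<beta> a)),
        (min (\<beta> a) (\<beta> b), max (\<beta> a) (\<beta> b))}" (is "?L = ?R")
    proof (rule equalityI)
      show "?L \<subseteq> ?R"
      proof
        fix x assume "x \<in> ?L"
        then obtain i j where x: "x = (i, j)" and ij: "i \<in> A" "j \<in> A" "i < j"
          and "v i = a \<and> v j = b \<or> v i = b \<and> v j = a"
          using psi y by auto
        then have "(i = a \<or> i = \<beta> a) \<and> (j = b \<or> j = \<beta> b) \<or> (i = b \<or> i = \<beta> b) \<and> (j = a \<or> j = \<beta> a)"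
          using v_eq[OF _ a] v_eq[OF _ b] by auto
        then show "x \<in> ?R" using ij A ab unfolding x by (auto simp: min_def max_def)
      qed
      have "v a = a" "v b = b" "v (\<beta> a) = a" "v (\<beta> b) = b"
        using v_eq[OF _ a] v_eq[OF _ b] A by auto
      then show "?R \<subseteq> ?L"
        using A ab ne invol[of a] invol[of b] unfolding y
        by (auto simp: psi min_def max_def)
    qed
    \<comment> \<open>The orderings and \<open>ne\<close> make the four pairs distinct, so the
      product over this set really has four factors.\<close>
    moreover have "prod ?f ?R = ?g (a, b)"
      using ab A(3,4) ne ne[symmetric] by (auto simp: min_def max_def mult.assoc dest: less_imp_neq)
    ultimately show "prod ?f {x \<in> ?S. \<psi> x = y} = ?g y" using y by simp
  qed
  finally show ?thesis .
qed

text \<open>Each two-element subset has exactly one increasing listing, so \<open>n_subsets\<close>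
  does the counting.\<close>

lemma card_pairs_less:
  fixes I :: "'a::linorder set"
  assumes "finite I"
  shows "card {(r, s). r \<in> I \<and> s \<in> I \<and> r < s} = card I choose 2"
proof -
  have "bij_betw (\<lambda>(r, s). {r, s}) {(r, s). r \<in> I \<and> s \<in> I \<and> r < s} {B. B \<subseteq> I \<and> card B = 2}"
    unfolding bij_betw_def
  proof
    show "inj_on (\<lambda>(r, s). {r, s}) {(r, s). r \<in> I \<and> s \<in> I \<and> r < s}"
      by (auto simp: inj_on_def doubleton_eq_iff)
    show "(\<lambda>(r, s). {r, s}) ` {(r, s). r \<in> I \<and> s \<in> I \<and> r < s} = {B. B \<subseteq> I \<and> card B = 2}"
      (is "?f ` ?S = ?T")
    proof
      show "?f ` ?S \<subseteq> ?T" by auto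
      show "?T \<subseteq> ?f ` ?S"
      proof
        fix B assume B: "B \<in> ?T"
        then obtain r s where rs: "B = {r, s}" "r \<noteq> s" by (auto simp: card_2_iff)
        then have "B = ?f (min r s, max r s)" "(min r s, max r s) \<in> ?S"
          using B by (auto simp: min_def max_def)
        then show "B \<in> ?f ` ?S" by blast
      qed
    qed
  qed
  then show ?thesis
    using n_subsets[OF assms, of 2] bij_betw_same_card by fastforce
qed

text \<open>The factors of \<open>(r, s)\<close> and \<open>(s, r)\<close> multiply to minus a
  square, which gives one sign for each pair \<open>r < s\<close>.\<close>

lemma prod_diff_distinct:
  fixes I :: "'a::linorder set" and x :: "'a \<Rightarrow> 'b::comm_ring_1"
  assumes fin: "finite I"
  shows "(\<Prod>(r, s) \<in> {(r, s). r \<in> I \<and> s \<in> I \<and> r \<noteq> s}. x r - x s) =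
    (-1) ^ (card I choose 2) * (\<Prod>(r, s) \<in> {(r, s). r \<in> I \<and> s \<in> I \<and> r < s}. (x s - x r)\<^sup>2)"
proof -
  let ?S = "{(r, s). r \<in> I \<and> s \<in> I \<and> r < s}" and ?S' = "{(r, s). r \<in> I \<and> s \<in> I \<and> s < r}"
  have f: "finite ?S" "finite ?S'"
    by (rule finite_subset[of _ "I \<times> I"]; use fin in auto)+
  have "{(r, s). r \<in> I \<and> s \<in> I \<and> r \<noteq> s} = ?S \<union> ?S'" by auto
  then have "(\<Prod>(r, s) \<in> {(r, s). r \<in> I \<and> s \<in> I \<and> r \<noteq> s}. x r - x s) =
      (\<Prod>(r, s) \<in> ?S. x r - x s) * (\<Prod>(r, s) \<in> ?S'. x r - x s)"
    by (simp only:) (rule prod.union_disjoint[OF f], auto)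
  also have "(\<Prod>(r, s) \<in> ?S'. x r - x s) = (\<Prod>(r, s) \<in> ?S. x s - x r)"
    by (rule prod.reindex_bij_witness[of _ prod.swap prod.swap]) auto
  also have "(\<Prod>(r, s) \<in> ?S. x r - x s) * (\<Prod>(r, s) \<in> ?S. x s - x r) =
      (\<Prod>(r, s) \<in> ?S. - 1 * (x s - x r)\<^sup>2)"
    unfolding prod.distrib[symmetric]
    by (rule prod.cong) (auto simp: power2_eq_square algebra_simps)
  also have "\<dots> = (\<Prod>(r, s) \<in> ?S. - 1) * (\<Prod>(r, s) \<in> ?S. (x s - x r)\<^sup>2)"
    unfolding prod.distrib[symmetric] by (rule prod.cong) auto
  also have "(\<Prod>(r, s) \<in> ?S. - 1 :: 'b) = (-1) ^ (card I choose 2)"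
    using card_pairs_less[OF fin] by (simp add: case_prod_unfold)
  finally show ?thesis .
qed

text \<open>The right-hand side depends on the set of values only. Two injective parametrisations of
  one set, even over different index types, therefore give equal products.\<close>

lemma prod_diff_distinct_image:
  fixes x :: "'a \<Rightarrow> 'b::comm_ring_1"
  assumes "inj_on x I"
  shows "(\<Prod>(r, s) \<in> {(r, s). r \<in> I \<and> s \<in> I \<and> r \<noteq> s}. x r - x s) =
    (\<Prod>(u, v) \<in> {(u, v). u \<in> x ` I \<and> v \<in> x ` I \<and> u \<noteq> v}. u - v)"
proof -
  have "bij_betw (map_prod x x) {(r, s). r \<in> I \<and> s \<in> I \<and> r \<noteq> s}
      {(u, v). u \<in> x ` I \<and> v \<in> x ` I \<and> u \<noteq> v}"
    using assms by (auto simp: bij_betw_def inj_on_def image_iff)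
  from prod.reindex_bij_betw[OF this, of "\<lambda>(u, v). u - v"]
  show ?thesis by (simp add: case_prod_unfold)
qed

text \<open>\<open>\<beta>\<close> exchanges the elements below their image with those above
  it.\<close>

lemma card_involution:
  fixes A :: "'a::linorder set"
  assumes fin: "finite A" and closed: "\<And>x. x \<in> A \<Longrightarrow> \<beta> x \<in> A"
    and invol: "\<And>x. x \<in> A \<Longrightarrow> \<beta> (\<beta> x) = x" and no_fix: "\<And>x. x \<in> A \<Longrightarrow> \<beta> x \<noteq> x"
  shows "card A = 2 * card {x \<in> A. x < \<beta> x}"
proof -
  have "bij_betw \<beta> {x \<in> A. x < \<beta> x} {x \<in> A. \<beta> x < x}"
    by (rule bij_betw_byWitness[of _ \<beta>]) (use closed invol in auto)
  then have "card {x \<in> A. x < \<beta> x} = card {x \<in> A. \<beta> x < x}" by (rule bij_betw_same_card)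
  moreover have "A = {x \<in> A. x < \<beta> x} \<union> {x \<in> A. \<beta> x < x}"
    using no_fix neqE by auto
  then have "card A = card {x \<in> A. x < \<beta> x} + card {x \<in> A. \<beta> x < x}"
    using fin by (metis (no_types, lifting) card_Un_disjoint disjoint_iff finite_Un mem_Collect_eq order_less_asym)
  ultimately show ?thesis by simp
qed

section \<open>The involution \<open>bar\<close> modulo a prime \<open>p = 4 * n + 1\<close>\<close>

locale prime_1_mod_4 =
  fixes p n :: nat
  assumes prime_p: "prime p" and p_eq: "p = 4 * n + 1"
begin

lemma n_pos: "n > 0"
  using prime_p p_eq by (cases n) auto

lemma half_eq: "(int p - 1) div 2 = 2 * int n"
  using p_eq by simp

lemma prime_int: "prime (int p)"
  using prime_p by simp

text \<open>In Wilson's theorem the upper half of the factors is \<open>p - x\<close> for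
  \<open>x\<close> in the lower half, that is \<open>- x\<close> modulo \<open>p\<close>.\<close>

lemma half_fact_square: "[(half_fact p)\<^sup>2 = - 1] (mod int p)"
proof -
  let ?A = "{1..2 * int n}" and ?B = "{2 * int n + 1..4 * int n}"
  have "(fact (p - 1) :: int) = (\<Prod>k \<in> {1..4 * n}. int k)"
    by (simp add: p_eq fact_prod)
  also have "\<dots> = \<Prod>{1..4 * int n}"
    by (rule prod.reindex_bij_witness[of _ nat int]) auto
  also have "{1..4 * int n} = ?A \<union> ?B" by auto
  also have "\<Prod>\<dots> = half_fact p * \<Prod>?B"
    by (subst prod.union_disjoint) (auto simp: half_fact_def half_eq)
  also have "\<Prod>?B = (\<Prod>x \<in> ?A. int p - x)"
    by (rule prod.reindex_bij_witness[of _ "\<lambda>x. int p - x" "\<lambda>x. int p - x"]) (auto simp: p_eq)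
  finally have "[- 1 = half_fact p * (\<Prod>x \<in> ?A. int p - x)] (mod int p)"
    using wilson_theorem[OF prime_p] by (simp add: cong_sym)
  also have "[half_fact p * (\<Prod>x \<in> ?A. int p - x) = half_fact p * (\<Prod>x \<in> ?A. - x)] (mod int p)"
    by (intro cong_mult cong_refl cong_prod) (auto simp: cong_iff_dvd_diff)
  \<comment> \<open>There are \<open>2 * n\<close> factors, an even number, so the signs
    cancel.\<close>
  also have "(\<Prod>x \<in> ?A. - x) = half_fact p"
    by (simp add: prod_uminus half_fact_def half_eq nat_mult_distrib)
  finally show ?thesis by (simp add: power2_eq_square cong_sym)
qed

lemma abs_res_square: "[(abs_res p x)\<^sup>2 = x\<^sup>2] (mod int p)"
proof -
  have "[abs_res p x = x] (mod int p) \<or> [abs_res p x = - x] (mod int p)"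
    by (auto simp: abs_res_def least_res_def cong_def mod_simps)
  then show ?thesis
    using cong_pow[of "abs_res p x" x "int p" 2] cong_pow[of "abs_res p x" "- x" "int p" 2] by auto
qed

lemma abs_res_range:
  assumes "\<not> int p dvd x"
  shows "abs_res p x \<in> {1..2 * int n}"
proof -
  define m where "m = x mod int p"
  have "m \<noteq> 0" "m \<ge> 0" "m < int p" "int p = 4 * int n + 1"
    using assms by (auto simp: m_def p_eq dvd_eq_mod_eq_0)
  then show ?thesis unfolding abs_res_def least_res_def m_def[symmetric] by auto
qed

lemma not_dvd:
  assumes "x \<in> {1..2 * int n}"
  shows "\<not> int p dvd x"
  using assms p_eq zdvd_not_zless[of x "int p"] by auto

text \<open>\<open>p\<close> divides \<open>x - y\<close> or \<open>x + y\<close>. The second is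
  impossible since \<open>0 < x + y < p\<close>, and the first forces equality since
  \<open>x - y\<close> is smaller than \<open>p\<close> in absolute value.\<close>

lemma half_square_inj:
  assumes "x \<in> {1..2 * int n}" "y \<in> {1..2 * int n}" "[x\<^sup>2 = y\<^sup>2] (mod int p)"
  shows "x = y"
proof -
  have "int p dvd (x - y) * (x + y)"
    using assms(3) by (simp add: cong_iff_dvd_diff power2_eq_square algebra_simps)
  then consider "int p dvd x - y" | "int p dvd x + y"
    using prime_int by (auto simp: prime_dvd_mult_iff)
  then show ?thesis
  proof cases
    case 1
    then show ?thesis using assms(1,2) p_eq dvd_imp_le_int[of "x - y" "int p"] by force
  next
    case 2
    then show ?thesis using assms(1,2) p_eq zdvd_not_zless[of "x + y" "int p"] by auto
  qed
qed

lemma bar_square: "[(bar p x)\<^sup>2 = - (x\<^sup>2)] (mod int p)"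
proof -
  have "[(bar p x)\<^sup>2 = (half_fact p)\<^sup>2 * x\<^sup>2] (mod int p)"
    using abs_res_square[of "half_fact p * x"] by (simp add: bar_def power_mult_distrib)
  also have "[(half_fact p)\<^sup>2 * x\<^sup>2 = - 1 * x\<^sup>2] (mod int p)"
    by (intro cong_mult half_fact_square cong_refl)
  finally show ?thesis by simp
qed

text \<open>\<open>half_fact p\<close> is a unit modulo \<open>p\<close> because its square is -1,
  so multiplying by it keeps \<open>x\<close> nonzero modulo \<open>p\<close>.\<close>

lemma bar_range:
  assumes "x \<in> {1..2 * int n}"
  shows "bar p x \<in> {1..2 * int n}"
proof -
  have "\<not> int p dvd half_fact p"
  proof
    assume "int p dvd half_fact p"
    then have "int p dvd (half_fact p)\<^sup>2" by (simp add: power2_eq_square)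
    then have "int p dvd - 1" using half_fact_square cong_dvd_iff by blast
    then show False using p_eq n_pos by simp
  qed
  then show ?thesis
    unfolding bar_def using not_dvd[OF assms] prime_int
    by (intro abs_res_range) (simp add: prime_dvd_mult_iff)
qed

text \<open>This identifies the pairs excluded from the product with the chords. The square of
  \<open>y\<close> is determined modulo \<open>p\<close>, and \<open>half_square_inj\<close>
  recovers \<open>y\<close> from it.\<close>

lemma eq_bar_iff:
  assumes "x \<in> {1..2 * int n}" "y \<in> {1..2 * int n}"
  shows "y = bar p x \<longleftrightarrow> [x\<^sup>2 + y\<^sup>2 = 0] (mod int p)"
proof
  assume "y = bar p x"
  then have "[x\<^sup>2 + y\<^sup>2 = x\<^sup>2 + - (x\<^sup>2)] (mod int p)"
    using bar_square[of x] by (intro cong_add) auto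
  then show "[x\<^sup>2 + y\<^sup>2 = 0] (mod int p)" by simp
next
  assume "[x\<^sup>2 + y\<^sup>2 = 0] (mod int p)"
  then have "[x\<^sup>2 + y\<^sup>2 - x\<^sup>2 = 0 - x\<^sup>2] (mod int p)" by (intro cong_diff cong_refl)
  then have "[y\<^sup>2 = (bar p x)\<^sup>2] (mod int p)"
    using bar_square[of x] by (simp add: cong_def)
  then show "y = bar p x" using half_square_inj assms bar_range by blast
qed

text \<open>The relation characterising \<open>bar\<close> in \<open>eq_bar_iff\<close> is symmetric
  in \<open>x\<close> and \<open>y\<close>.\<close>

lemma bar_bar:
  assumes "x \<in> {1..2 * int n}"
  shows "bar p (bar p x) = x"
  using eq_bar_iff[of x "bar p x"] eq_bar_iff[of "bar p x" x] bar_range[OF assms] assms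
  by (simp add: add.commute)

text \<open>A fixed point would make \<open>p\<close> divide \<open>2 * x\<^sup>2\<close>, hence 2,
  whereas \<open>p\<close> is at least 5.\<close>

lemma bar_neq:
  assumes "x \<in> {1..2 * int n}"
  shows "bar p x \<noteq> x"
proof
  assume "bar p x = x"
  then have "[x\<^sup>2 + x\<^sup>2 = 0] (mod int p)" using eq_bar_iff[of x x] assms by simp
  then have "int p dvd 2 * x\<^sup>2" by (simp add: cong_0_iff)
  then have "int p dvd 2"
    using prime_int not_dvd[OF assms] by (simp add: prime_dvd_mult_iff prime_dvd_power_iff)
  then show False using p_eq n_pos zdvd_imp_le[of "int p" 2] by simp
qed

lemma V_eq: "V_set p = {x \<in> {1..2 * int n}. x < bar p x}"
  by (auto simp: V_set_def bar_def half_eq)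

lemma card_V: "card (V_set p) = n"
  using card_involution[of "{1..2 * int n}" "bar p", OF _ bar_range bar_bar bar_neq]
  by (simp add: V_eq nat_mult_distrib)

section \<open>Fourth powers of left ends and crossing chords\<close>

text \<open>Equal fourth powers mean that the squares agree up to sign. Equal squares give
  \<open>a = b\<close>; opposite squares make \<open>a\<close> and \<open>b\<close> the two ends of
  one chord, which cannot both be left ends.\<close>

lemma V_fourth_power_inj:
  assumes "a \<in> V_set p" "b \<in> V_set p" "[a ^ 4 = b ^ 4] (mod int p)"
  shows "a = b"
proof -
  have ab: "a \<in> {1..2 * int n}" "b \<in> {1..2 * int n}" "a < bar p a" "b < bar p b"
    using assms by (auto simp: V_eq)
  have "int p dvd (a\<^sup>2 - b\<^sup>2) * (a\<^sup>2 + b\<^sup>2)"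
    using assms(3) by (simp add: cong_iff_dvd_diff algebra_simps power2_eq_square power4_eq_xxxx)
  then consider "int p dvd a\<^sup>2 - b\<^sup>2" | "int p dvd a\<^sup>2 + b\<^sup>2"
    using prime_int by (auto simp: prime_dvd_mult_iff)
  then show ?thesis
  proof cases
    case 1
    then show ?thesis using half_square_inj ab by (simp add: cong_iff_dvd_diff)
  next
    case 2
    then have "b = bar p a" using eq_bar_iff ab by (simp add: cong_0_iff)
    then show ?thesis using ab bar_bar[of a] by auto
  qed
qed

text \<open>Modulo \<open>p\<close> the squares of \<open>A\<close> and \<open>B\<close> are
  \<open>- u\<close> and \<open>- v\<close>, so every factor becomes \<open>v - u\<close> or
  \<open>v + u\<close> up to sign, each occurring twice. The order of the four ends decides the
  total sign.\<close>

lemma crossing_factor: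
  assumes "a \<in> V_set p" "b \<in> V_set p" "a < b"
  defines "A \<equiv> bar p a" and "B \<equiv> bar p b"
  shows "[(b\<^sup>2 - a\<^sup>2) * (B\<^sup>2 - a\<^sup>2) * ((max b A)\<^sup>2 - (min b A)\<^sup>2) * ((max A B)\<^sup>2 - (min A B)\<^sup>2) =
    (if (a, b) \<in> X_set p then - 1 else 1) * (b ^ 4 - a ^ 4)\<^sup>2] (mod int p)"
proof -
  define u v where "u = a\<^sup>2" and "v = b\<^sup>2"
  have ab: "a \<in> {1..2 * int n}" "b \<in> {1..2 * int n}" "a < A" "b < B"
    using assms by (auto simp: V_eq)
  have sq: "[A\<^sup>2 = - u] (mod int p)" "[B\<^sup>2 = - v] (mod int p)"
    unfolding A_def B_def u_def v_def by (rule bar_square)+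
  have "A \<noteq> b" using ab assms(3) bar_bar[of a] by (auto simp: A_def B_def)
  moreover have "A \<noteq> B" using bar_bar[of a] bar_bar[of b] ab assms(3) by (auto simp: A_def B_def)
  moreover have X: "(a, b) \<in> X_set p \<longleftrightarrow> b < A \<and> A < B"
    using assms by (auto simp: X_set_def)
  \<comment> \<open>The chords cross, are nested, or are disjoint. In the disjoint case
    \<open>A < B\<close> is automatic from \<open>A < b < B\<close>.\<close>
  ultimately consider "b < A" "A < B" "(a, b) \<in> X_set p" | "b < A" "B < A" "(a, b) \<notin> X_set p"
    | "A < b" "A < B" "(a, b) \<notin> X_set p"
    using ab by fastforce
  then show ?thesis
  proof cases
    case 1
    have "[(v - u) * (B\<^sup>2 - u) * (A\<^sup>2 - v) * (B\<^sup>2 - A\<^sup>2) =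
        (v - u) * (- v - u) * (- u - v) * (- v - - u)] (mod int p)"
      by (intro cong_mult cong_diff sq cong_refl)
    with 1 show ?thesis by (simp add: u_def v_def algebra_simps power2_eq_square power4_eq_xxxx)
  next
    case 2
    have "[(v - u) * (B\<^sup>2 - u) * (A\<^sup>2 - v) * (A\<^sup>2 - B\<^sup>2) =
        (v - u) * (- v - u) * (- u - v) * (- u - - v)] (mod int p)"
      by (intro cong_mult cong_diff sq cong_refl)
    with 2 show ?thesis by (simp add: u_def v_def algebra_simps power2_eq_square power4_eq_xxxx)
  next
    case 3
    have "[(v - u) * (B\<^sup>2 - u) * (v - A\<^sup>2) * (B\<^sup>2 - A\<^sup>2) =
        (v - u) * (- v - u) * (v - - u) * (- v - - u)] (mod int p)"
      by (intro cong_mult cong_diff sq cong_refl)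
    with 3 show ?thesis by (simp add: u_def v_def algebra_simps power2_eq_square power4_eq_xxxx)
  qed
qed

text \<open>The factors are grouped in fours by \<open>prod_pairs_involution\<close>, and
  \<open>crossing_factor\<close> evaluates each group; every crossing contributes one sign.\<close>

lemma prod_square_diff_cong:
  "[(\<Prod>(i, j) \<in> {(i, j). 1 \<le> i \<and> i < j \<and> j \<le> (int p - 1) div 2 \<and>
       \<not> [i\<^sup>2 + j\<^sup>2 = 0] (mod int p)}. j\<^sup>2 - i\<^sup>2) =
    (-1) ^ card (X_set p) *
      (\<Prod>(a, b) \<in> {(a, b). a \<in> V_set p \<and> b \<in> V_set p \<and> a < b}. (b ^ 4 - a ^ 4)\<^sup>2)] (mod int p)"
proof -
  let ?T = "{(a, b). a \<in> V_set p \<and> b \<in> V_set p \<and> a < b}"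
  have finT: "finite ?T"
    by (rule finite_subset[of _ "{1..2 * int n} \<times> {1..2 * int n}"]) (auto simp: V_eq)
  have "{(i, j). 1 \<le> i \<and> i < j \<and> j \<le> (int p - 1) div 2 \<and> \<not> [i\<^sup>2 + j\<^sup>2 = 0] (mod int p)} =
      {(i, j). i \<in> {1..2 * int n} \<and> j \<in> {1..2 * int n} \<and> i < j \<and> j \<noteq> bar p i}"
    unfolding half_eq using eq_bar_iff eq_bar_iff[OF _ bar_range] by fastforce
  then have "(\<Prod>(i, j) \<in> {(i, j). 1 \<le> i \<and> i < j \<and> j \<le> (int p - 1) div 2 \<and>
       \<not> [i\<^sup>2 + j\<^sup>2 = 0] (mod int p)}. j\<^sup>2 - i\<^sup>2) =
      (\<Prod>(a, b) \<in> ?T. (b\<^sup>2 - a\<^sup>2) * ((bar p b)\<^sup>2 - a\<^sup>2) * ((max b (bar p a))\<^sup>2 - (min b (bar p a))\<^sup>2) *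
         ((max (bar p a) (bar p b))\<^sup>2 - (min (bar p a) (bar p b))\<^sup>2))" (is "?lhs = ?P")
    using prod_pairs_involution[of "{1..2 * int n}" "bar p" "\<lambda>i j. j\<^sup>2 - i\<^sup>2",
        OF _ bar_range bar_bar bar_neq]
    by (simp flip: V_eq del: atLeastAtMost_iff)
  moreover have "[?P = (\<Prod>(a, b) \<in> ?T. (if (a, b) \<in> X_set p then - 1 else 1) * (b ^ 4 - a ^ 4)\<^sup>2)] (mod int p)"
    (is "[_ = ?P'] (mod _)")
    using crossing_factor by (intro cong_prod) auto
  moreover have "?P' = (-1) ^ card (X_set p) * (\<Prod>(a, b) \<in> ?T. (b ^ 4 - a ^ 4)\<^sup>2)"
  proof -
    \<comment> \<open>All members of \<open>X_set p\<close> occur among the index pairs, so the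
      number of signs is exactly its cardinality.\<close>
    have "?T \<inter> X_set p = X_set p" by (auto simp: X_set_def)
    then have "(\<Prod>x \<in> ?T. if x \<in> X_set p then - 1 else 1 :: int) = (-1) ^ card (X_set p)"
      using finT by (simp add: prod.If_cases)
    moreover have "?P' = (\<Prod>x \<in> ?T. if x \<in> X_set p then - 1 else 1) * (\<Prod>(a, b) \<in> ?T. (b ^ 4 - a ^ 4)\<^sup>2)"
      unfolding prod.distrib[symmetric] case_prod_unfold prod.collapse ..
    ultimately show ?thesis by (simp only:)
  qed
  ultimately show ?thesis by (simp only:)
qed

section \<open>Fourth powers as powers of a primitive root\<close>

text \<open>Each \<open>a\<close> in \<open>V_set p\<close> is a power of \<open>g\<close>, which
  gives one inclusion of images. The smaller image has \<open>n\<close> elements and the larger at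
  most \<open>n\<close>, so counting yields both the equality and the injectivity of the second
  map.\<close>

lemma fourth_powers_mod:
  assumes "int_primroot p g"
  shows "inj_on (\<lambda>a. a ^ 4 mod int p) (V_set p)"
    and "inj_on (\<lambda>r. g ^ (4 * r) mod int p) {1..n}"
    and "(\<lambda>a. a ^ 4 mod int p) ` V_set p = (\<lambda>r. g ^ (4 * r) mod int p) ` {1..n}"
proof -
  let ?F = "\<lambda>a. a ^ 4 mod int p" and ?G = "\<lambda>r. g ^ (4 * r) mod int p"
  show inj: "inj_on ?F (V_set p)"
    using V_fourth_power_inj by (auto simp: inj_on_def cong_def)
  define h where "h = nat (g mod int p)"
  have h: "residue_primroot p h" using assms by (simp add: int_primroot_def least_res_def h_def)
  have "int h = g mod int p" using p_eq by (simp add: h_def)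
  then have gh: "[int h = g] (mod int p)" by simp
  \<comment> \<open>Euler's theorem, with \<open>4 * n\<close> as the totient of
    \<open>p\<close>.\<close>
  have period: "[g ^ (4 * n) = 1] (mod int p)"
  proof -
    have "[h ^ (4 * n) = 1] (mod p)"
      using h euler_theorem[of h p] totient_prime[OF prime_p] p_eq
      by (simp add: residue_primroot_def coprime_commute)
    then have "[int h ^ (4 * n) = 1] (mod int p)"
      by (metis cong_int_iff of_nat_1 of_nat_power)
    then show ?thesis using cong_pow[OF gh] cong_trans cong_sym by blast
  qed
  have sub: "?F ` V_set p \<subseteq> ?G ` {1..n}"
  proof
    fix y assume "y \<in> ?F ` V_set p"
    then obtain a where a: "a \<in> {1..2 * int n}" and y: "y = a ^ 4 mod int p" by (auto simp: V_eq)
    have "nat a \<in> totatives p"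
      unfolding totatives_prime[OF prime_p] using a by (auto simp: p_eq)
    then obtain i where i: "nat a = h ^ i mod p"
      using residue_primroot_is_generator[OF _ h] p_eq n_pos by (auto simp: bij_betw_def)
    have "a = int (nat a)" using a by simp
    also have "\<dots> = int h ^ i mod int p" unfolding i by (simp add: of_nat_mod)
    finally have "[a = int h ^ i] (mod int p)" by simp
    then have "[a = g ^ i] (mod int p)" using cong_pow[OF gh] cong_trans by blast
    then have ag: "[a ^ 4 = g ^ (4 * i)] (mod int p)"
      using cong_pow[of a "g ^ i" "int p" 4] by (simp add: power_mult[symmetric] mult.commute)
    \<comment> \<open>The exponents run over \<open>{1..n}\<close>, so the residue class of 0 modulo
      \<open>n\<close> is represented by \<open>n\<close>.\<close>
    define r where "r = (if i mod n = 0 then n else i mod n)"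
    have r: "r \<in> {1..n}" using n_pos by (auto simp: r_def Suc_le_eq less_imp_le)
    have "[r = i] (mod n)" by (auto simp: r_def cong_def)
    \<comment> \<open>Congruence of \<open>r\<close> and \<open>i\<close> modulo \<open>n\<close>
      suffices: after multiplication by 4 it is a congruence modulo the period \<open>4 * n\<close>
      of the powers of \<open>g\<close>.\<close>
    then have mult: "[4 * r = 4 * i] (mod (4 * n))"  by (simp add: cong_def mult_mod_right[symmetric])
    have pw: "[g ^ k = g ^ (k mod (4 * n))] (mod int p)" for k
    proof -
      have "[g ^ (4 * n * (k div (4 * n)) + k mod (4 * n)) = 1 ^ (k div (4 * n)) * g ^ (k mod (4 * n))] (mod int p)"
        unfolding power_add power_mult[of g "4 * n"] by (intro cong_mult cong_pow period cong_refl)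
      then show ?thesis by (simp only: mult_div_mod_eq power_one mult_1)
    qed
    have "[g ^ (4 * i) = g ^ (4 * r)] (mod int p)"
      using pw[of "4 * i"] pw[of "4 * r"] mult by (simp add: cong_def)
    then have "y = ?G r" using ag y by (simp add: cong_def)
    then show "y \<in> ?G ` {1..n}" using r by blast
  qed
  have card_le: "card (?G ` {1..n}) \<le> n"
    using card_image_le[of "{1..n}" ?G] by simp
  have "card (?F ` V_set p) = n" using card_image[OF inj] card_V by simp
  then show eq: "?F ` V_set p = ?G ` {1..n}"
    using sub card_le by (intro card_subset_eq) (auto intro: card_mono order_antisym)
  then show "inj_on ?G {1..n}"
    using \<open>card (?F ` V_set p) = n\<close> by (intro eq_card_imp_inj_on) auto
qed

text \<open>The two families agree only modulo \<open>p\<close>. Reducing every term turns them into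
  the same set of integers, where \<open>prod_diff_distinct_image\<close> applies; afterwards the
  reduction is undone.\<close>

lemma prod_fourth_powers_cong:
  assumes "int_primroot p g"
  shows "[(\<Prod>(r, s) \<in> {(r, s). r \<in> {1..n} \<and> s \<in> {1..n} \<and> r \<noteq> s}. g ^ (4 * r) - g ^ (4 * s)) =
    (\<Prod>(a, b) \<in> {(a, b). a \<in> V_set p \<and> b \<in> V_set p \<and> a \<noteq> b}. a ^ 4 - b ^ 4)] (mod int p)"
proof -
  have "[(\<Prod>(r, s) \<in> {(r, s). r \<in> {1..n} \<and> s \<in> {1..n} \<and> r \<noteq> s}. g ^ (4 * r) - g ^ (4 * s)) =
      (\<Prod>(r, s) \<in> {(r, s). r \<in> {1..n} \<and> s \<in> {1..n} \<and> r \<noteq> s}. g ^ (4 * r) mod int p - g ^ (4 * s) mod int p)]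
      (mod int p)"
    by (intro cong_prod) (auto intro!: cong_diff)
  also have "(\<Prod>(r, s) \<in> {(r, s). r \<in> {1..n} \<and> s \<in> {1..n} \<and> r \<noteq> s}. g ^ (4 * r) mod int p - g ^ (4 * s) mod int p) =
      (\<Prod>(a, b) \<in> {(a, b). a \<in> V_set p \<and> b \<in> V_set p \<and> a \<noteq> b}. a ^ 4 mod int p - b ^ 4 mod int p)"
    using prod_diff_distinct_image[OF fourth_powers_mod(1)[OF assms]]
      prod_diff_distinct_image[OF fourth_powers_mod(2)[OF assms]] fourth_powers_mod(3)[OF assms]
    by metis
  also have "[\<dots> = (\<Prod>(a, b) \<in> {(a, b). a \<in> V_set p \<and> b \<in> V_set p \<and> a \<noteq> b}. a ^ 4 - b ^ 4)] (mod int p)"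
    by (intro cong_prod) (auto intro!: cong_diff)
  finally show ?thesis .
qed

section \<open>Comparison of signs\<close>

text \<open>\<open>(p - 1) * (p - 5)\<close> is 96 times \<open>L_num p\<close> and also
  \<open>16 * n * (n - 1)\<close>, which is 32 times \<open>n choose 2\<close>; the ratio 3 is
  odd.\<close>

lemma parity_L: "even (L_num p) \<longleftrightarrow> even (n choose 2)"
proof -
  have "96 * int (L_num p) = (int p - 1) * (int p - 5)"
    using L_num_exact[OF prime_p] p_eq by (simp add: cong_def)
  also have "\<dots> = 16 * (int n * (int n - 1))" unfolding p_eq by (simp add: algebra_simps)
  also have "int n * (int n - 1) = int (n * (n - 1))" using n_pos by simp
  also have "n * (n - 1) = 2 * (n choose 2)" by (cases n) (simp_all add: choose_two)
  finally have "n choose 2 = 3 * L_num p" by simp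
  then show ?thesis by simp
qed

end

theorem theorem2p2:
  fixes p :: nat and g :: int
  assumes "prime p" and "[p = 1] (mod 4)" and "int_primroot p g"
  shows "[(\<Prod>(i, j) \<in> {(i, j). 1 \<le> i \<and> i < j \<and> j \<le> (int p - 1) div 2 \<and>
                               \<not> [i\<^sup>2 + j\<^sup>2 = 0] (mod int p)}. j\<^sup>2 - i\<^sup>2) =
          (-1) ^ (card (X_set p) + L_num p) *
          (\<Prod>(r, s) \<in> {(r, s). r \<in> {1..(p - 1) div 4} \<and> s \<in> {1..(p - 1) div 4} \<and> r \<noteq> s}.
             g ^ (4 * r) - g ^ (4 * s))] (mod int p)"
proof -
  define n where "n = (p - 1) div 4"
  have "p mod 4 = 1" using assms(2) by (simp add: cong_def)
  then have "p = 4 * n + 1" unfolding n_def by presburger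
  then interpret prime_1_mod_4 p n using assms(1) by unfold_locales
  let ?Q = "\<Prod>(a, b) \<in> {(a, b). a \<in> V_set p \<and> b \<in> V_set p \<and> a < b}. (b ^ 4 - a ^ 4)\<^sup>2"
  let ?R = "\<Prod>(r, s) \<in> {(r, s). r \<in> {1..n} \<and> s \<in> {1..n} \<and> r \<noteq> s}. g ^ (4 * r) - g ^ (4 * s)"
  have "finite (V_set p)" unfolding V_eq by (rule finite_Collect_conjI) simp
  then have "[?R = (-1) ^ (n choose 2) * ?Q] (mod int p)"
    using prod_fourth_powers_cong[OF assms(3)] prod_diff_distinct[of "V_set p" "\<lambda>a. a ^ 4"]
    by (simp add: card_V)
  then have "[(-1) ^ (card (X_set p) + L_num p) * ?R =
      (-1) ^ (card (X_set p) + L_num p) * ((-1) ^ (n choose 2) * ?Q)] (mod int p)"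
    by (intro cong_mult cong_refl)
  \<comment> \<open>The signs with exponents \<open>L_num p\<close> and \<open>n choose 2\<close>
    are equal and cancel, leaving only the sign that counts crossings.\<close>
  also have "(-1) ^ (card (X_set p) + L_num p) * ((-1) ^ (n choose 2) * ?Q) = (-1) ^ card (X_set p) * ?Q"
    using parity_L by (simp add: minus_one_power_iff)
  finally show ?thesis
    unfolding n_def[symmetric] using prod_square_diff_cong cong_sym cong_trans by blast
qed

end
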